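(* Let $d\ge 1$ be an integer and let $T(\mathscr{T})$ be the T-connected component of a T-mesh $\mathscr{T}$. Then there exists a unique complete partition $\{\overline T_{\mathrm{CNDC}},\overline T_{\mathrm D}\}$ of $T(\mathscr{T})$ (with respect to the degree $d$).
   Context: **T-mesh.** A T-mesh $\mathscr{T}=(\mathcal T_0,\mathcal T_1,\mathcal T_2)$ of $\mathbb R^2$ consists of a finite set $\mathcal T_2$ of closed axis-aligned rectangles (cells), a finite set $\mathcal T_1$ of closed horizontal and vertical segments (edges) contained in $\bigcup_{f\in\mathcal T_2}\partial f$, and the finite set $\mathcal T_0=\bigcup_{l\in\mathcal T_1}\partial l$ of vertices ($\partial l$ = endpoints of $l$), such that: each $\partial f$, $f\in\mathcal T_2$, is a finite union of edges; for distinct cells $f,f'$, $f\cap f'=\partial f\cap\partial f'$ is a finite union of elements of $\mathcal T_0\cup\mathcal T_1$; for distinct edges $l,l'$, $l\cap l'=\partial l\cap\partial l'\subseteq\mathcal T_0$; each vertex is the intersection of a horizontal and a vertical edge. The domain is $\Omega=\bigcup_{f\in\mathcal T_2}f$; it is assumed simply connected with connected interior $\Omega^0$. Vertices in $\Omega^0$ are interior vertices, the others boundary vertices; edges not contained in $\partial\Omega$ are interior edges. **$l$-edges.** A segment of $\mathscr T$ is a connected union of collinear mesh edges; an $l$-edge is a maximal such segment. An $l$-edge made of interior edges is an interior $l$-edge; a T $l$-edge is an interior $l$-edge whose two endpoints are both interior vertices. The T-connected component $T(\mathscr T)$ is the edge–vertex configuration formed by all T $l$-edges and all vertices lying on them;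 it is assumed connected. It is also assumed that no T $l$-edge is vanishable, i.e. every T $l$-edge carries at least $d+2$ vertices. **Bipartitions.** A bipartition $\{\overline T_1,\overline T_2\}$ of $T(\mathscr T)$ (an ordered pair) is given by splitting the set of T $l$-edges into two disjoint subsets $\mathcal L_1,\mathcal L_2$ (either may be empty): $\overline T_1$ consists of the $l$-edges in $\mathcal L_1$ with all their vertices; $\overline T_2$ consists of the $l$-edges in $\mathcal L_2$ with the vertices lying on them except those shared with an $l$-edge of $\mathcal L_1$, which are omitted. The vertices kept are called retained. For edge–vertex structures, $S\subseteq S'$ means every $l$-edge and every retained vertex of $S$ belongs to $S'$. **$s$-partitions.** Let $S$ be a component with $s$ $l$-edges. For an ordering $l_1\succ\cdots\succ l_s$ of these, let $\overline l_1=l_1$ and let $\overline l_i$ be $l_i$ with its retained vertices in $S$, with all vertices shared with $l_1,\dots,l_{i-1}$ removed. The set $\{\overline l_1,\dots,\overline l_s\}$ is an $s$-partition of $S$; $n(\overline l_i)$ is the number of vertices retained on $\overline l_i$. **Regular and complete partitions.** A nonempty component $S$ with $s$ $l$-edges is diagonalizable if it has an $s$-partition with $n(\overline l_i)\ge d+1$ for all $i$, and non-diagonalizable otherwise; an empty component is admitted in either role. A bipartition $\{\overline T_1,\overline T_2\}$ is a regular partition if $\overline T_1$ is non-diagonalizable and $\overline T_2$ is diagonalizable. A regular partition $\{\overline T_1,\overline T_2\}$ is a complete partition if no other regular partition $\{\overline T_1',\overline T_2'\}$ satisfies $\overline T_1'\subseteq\overline T_1$. In that case $\overline T_1$ is called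 the completely non-diagonalizable component (CNDC), denoted $\overline T_{\mathrm{CNDC}}$, and $\overline T_2$ is denoted $\overline T_{\mathrm D}$. *)

theory Defs
  imports "HOL-Analysis.Analysis"
begin

type_synonym point = "real \<times> real"

definition rectangle :: "point set \<Rightarrow> bool" where
  "rectangle f \<longleftrightarrow> (\<exists>a b c d. a < b \<and> c < d \<and> f = {a..b} \<times> {c..d})"

definition horizontal :: "point set \<Rightarrow> bool" where
  "horizontal l \<longleftrightarrow> (\<exists>a b y. a < b \<and> l = closed_segment (a, y) (b, y))"

definition vertical :: "point set \<Rightarrow> bool" where
  "vertical l \<longleftrightarrow> (\<exists>x a b. a < b \<and> l = closed_segment (x, a) (x, b))"

definition endpoints :: "point set \<Rightarrow> point set" where
  "endpoints l = {p. \<exists>q. l = closed_segment p q}"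

lemma endpoints_closed_segment: "endpoints (closed_segment p q) = {p, q}"
  unfolding endpoints_def
  by (auto simp: closed_segment_eq doubleton_eq_iff simp del: split_paired_Ex split_paired_All)

record tmesh =
  vertices :: "point set"
  edges :: "point set set"
  cells :: "point set set"

definition domain :: "tmesh \<Rightarrow> point set" where
  "domain M = \<Union>(cells M)"

text \<open>
  Cells and edges are nondegenerate. A union of finitely many edges is written as the union
  of a subset of the finite set of edges.
\<close>
definition is_tmesh :: "tmesh \<Rightarrow> bool" where
  "is_tmesh M \<longleftrightarrow>
     finite (cells M) \<and> (\<forall>f\<in>cells M. rectangle f) \<and>
     finite (edges M) \<and> (\<forall>l\<in>edges M. horizontal l \<or> vertical l) \<and>
     \<Union>(edges M) \<subseteq> (\<Union>f\<in>cells M. frontier f) \<and>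
     vertices M = (\<Union>l\<in>edges M. endpoints l) \<and>
     (\<forall>f\<in>cells M. \<exists>E\<subseteq>edges M. frontier f = \<Union>E) \<and>
     (\<forall>f\<in>cells M. \<forall>f'\<in>cells M. f \<noteq> f' \<longrightarrow>
        f \<inter> f' = frontier f \<inter> frontier f' \<and>
        (\<exists>V\<subseteq>vertices M. \<exists>E\<subseteq>edges M. f \<inter> f' = V \<union> \<Union>E)) \<and>
     (\<forall>l\<in>edges M. \<forall>l'\<in>edges M. l \<noteq> l' \<longrightarrow>
        l \<inter> l' = endpoints l \<inter> endpoints l' \<and> endpoints l \<inter> endpoints l' \<subseteq> vertices M) \<and>
     (\<forall>v\<in>vertices M. \<exists>h\<in>edges M. \<exists>k\<in>edges M. horizontal h \<and> vertical k \<and> h \<inter> k = {v}) \<and>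
     simply_connected (domain M) \<and>
     connected (interior (domain M))"

definition interior_vertices :: "tmesh \<Rightarrow> point set" where
  "interior_vertices M = vertices M \<inter> interior (domain M)"

definition interior_edges :: "tmesh \<Rightarrow> point set set" where
  "interior_edges M = {e \<in> edges M. \<not> e \<subseteq> frontier (domain M)}"

definition mesh_segment :: "tmesh \<Rightarrow> point set \<Rightarrow> bool" where
  "mesh_segment M s \<longleftrightarrow>
     (\<exists>E\<subseteq>edges M. E \<noteq> {} \<and> s = \<Union>E \<and> collinear s \<and> connected s)"

definition l_edge :: "tmesh \<Rightarrow> point set \<Rightarrow> bool" where
  "l_edge M l \<longleftrightarrow> mesh_segment M l \<and> (\<forall>s. mesh_segment M s \<and> l \<subseteq> s \<longrightarrow> s = l)"

definition interior_l_edge :: "tmesh \<Rightarrow> point set \<Rightarrow> bool" where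
  "interior_l_edge M l \<longleftrightarrow> l_edge M l \<and> (\<exists>E\<subseteq>interior_edges M. l = \<Union>E)"

definition T_l_edges :: "tmesh \<Rightarrow> point set set" where
  "T_l_edges M = {l. interior_l_edge M l \<and> endpoints l \<subseteq> interior_vertices M}"

record component =
  l_edges :: "point set set"
  retained :: "point set"

definition empty_component :: "component \<Rightarrow> bool" where
  "empty_component S \<longleftrightarrow> l_edges S = {}"

definition component_le :: "component \<Rightarrow> component \<Rightarrow> bool" where
  "component_le S S' \<longleftrightarrow> l_edges S \<subseteq> l_edges S' \<and> retained S \<subseteq> retained S'"

definition T_component :: "tmesh \<Rightarrow> component" where
  "T_component M =
     \<lparr>l_edges = T_l_edges M, retained = {v \<in> vertices M. \<exists>l\<in>T_l_edges M. v \<in> l}\<rparr>"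

text \<open>
  Since retained vertices lie on the l-edges, the configuration is connected iff the union of
  its l-edges is.
\<close>
definition component_connected :: "component \<Rightarrow> bool" where
  "component_connected S \<longleftrightarrow> connected (\<Union>(l_edges S))"

definition vanishable :: "nat \<Rightarrow> tmesh \<Rightarrow> point set \<Rightarrow> bool" where
  "vanishable d M l \<longleftrightarrow> \<not> d + 2 \<le> card {v \<in> vertices M. v \<in> l}"

definition bipartition :: "component \<Rightarrow> component \<Rightarrow> component \<Rightarrow> bool" where
  "bipartition T T1 T2 \<longleftrightarrow>
     (\<exists>L1 L2. L1 \<union> L2 = l_edges T \<and> L1 \<inter> L2 = {} \<and>
        T1 = \<lparr>l_edges = L1, retained = {v \<in> retained T. \<exists>l\<in>L1. v \<in> l}\<rparr> \<and>
        T2 = \<lparr>l_edges = L2,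
              retained = {v \<in> retained T. (\<exists>l\<in>L2. v \<in> l) \<and> (\<forall>l\<in>L1. v \<notin> l)}\<rparr>)"

text \<open>
  An ordering of the l-edges of a component is a distinct list, and an l-edge together with
  its remaining vertices is a pair.
\<close>
definition s_partition :: "component \<Rightarrow> (point set \<times> point set) set \<Rightarrow> bool" where
  "s_partition S P \<longleftrightarrow>
     (\<exists>ls. distinct ls \<and> set ls = l_edges S \<and>
        P = {(ls ! i, {v \<in> retained S. v \<in> ls ! i \<and> (\<forall>j<i. v \<notin> ls ! j)}) | i. i < length ls})"

text \<open>The empty component is both diagonalizable and non-diagonalizable.\<close>
definition diagonalizable :: "nat \<Rightarrow> component \<Rightarrow> bool" where
  "diagonalizable d S \<longleftrightarrow>
     empty_component S \<or> (\<exists>P. s_partition S P \<and> (\<forall>(l, V)\<in>P. d + 1 \<le> card V))"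

definition non_diagonalizable :: "nat \<Rightarrow> component \<Rightarrow> bool" where
  "non_diagonalizable d S \<longleftrightarrow> empty_component S \<or> \<not> diagonalizable d S"

definition regular_partition :: "nat \<Rightarrow> component \<Rightarrow> component \<Rightarrow> component \<Rightarrow> bool" where
  "regular_partition d T T1 T2 \<longleftrightarrow>
     bipartition T T1 T2 \<and> non_diagonalizable d T1 \<and> diagonalizable d T2"

definition complete_partition :: "nat \<Rightarrow> component \<Rightarrow> component \<Rightarrow> component \<Rightarrow> bool" where
  "complete_partition d T T1 T2 \<longleftrightarrow>
     regular_partition d T T1 T2 \<and>
     \<not> (\<exists>T1' T2'. regular_partition d T T1' T2' \<and> (T1', T2') \<noteq> (T1, T2) \<and> component_le T1' T1)"

end

theory Submission
  imports Defs
begin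

text \<open>
  Read backwards, an admissible ordering is a peeling process: the last \<open>l\<close>-edge has at least
  \<open>d + 1\<close> vertices on none of the others, so it can be removed, and then the next one, and so
  on. Removing \<open>l\<close>-edges only enlarges the sets of private vertices of the remaining ones, so
  peeling is confluent, as for the \<open>k\<close>-core of a graph, and it leaves the largest set of
  \<open>l\<close>-edges from which nothing can be peeled. That core is the CNDC.

  Orderings are eliminated by a criterion (\<open>diagonalizable_iff_peelable\<close>): a component is
  diagonalizable iff every nonempty set of its \<open>l\<close>-edges contains one with at least \<open>d + 1\<close>
  private vertices. Call a set of \<open>l\<close>-edges stuck if each member has at most \<open>d\<close> private
  vertices. Stuck sets are closed under unions, so there is a largest one, the core. Splitting
  off the core is a regular partition: a nonempty core violates the criterion, and anything in
  the remainder that violated it would enlarge the core. Conversely, by the criterion for its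
  second part, the first part of any regular partition contains the core. The core is thus the
  least first part of a regular partition, which gives existence and uniqueness at once.

  The argument is about a finite family of sets and the finitely many vertices on them; the
  mesh supplies the finiteness, because its \<open>l\<close>-edges and vertices arise from finitely many
  edges. A vertex is private to an \<open>l\<close>-edge, relative to a set of \<open>l\<close>-edges, if it lies on no
  other member of that set.
\<close>

section \<open>Diagonalizability without orderings\<close>

definition private_vertices :: "component \<Rightarrow> point set set \<Rightarrow> point set \<Rightarrow> point set" where
  "private_vertices S A l = {v \<in> retained S. v \<in> l \<and> (\<forall>l'\<in>A - {l}. v \<notin> l')}"

lemma finite_private_vertices:
  "finite (retained S) \<Longrightarrow> finite (private_vertices S A l)"
  by (simp add: private_vertices_def)

lemma private_vertices_antimono:
  "A \<subseteq> B \<Longrightarrow> private_vertices S B l \<subseteq> private_vertices S A l"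
  unfolding private_vertices_def by blast

lemma diagonalizable_iff_ordering:
  "diagonalizable d S \<longleftrightarrow>
     (\<exists>ls. distinct ls \<and> set ls = l_edges S \<and>
        (\<forall>i<length ls. d + 1 \<le> card {v \<in> retained S. v \<in> ls ! i \<and> (\<forall>j<i. v \<notin> ls ! j)}))"
  (is "_ \<longleftrightarrow> ?R")
proof
  assume "diagonalizable d S"
  then consider "l_edges S = {}" | P where "s_partition S P" "\<forall>(l, V)\<in>P. d + 1 \<le> card V"
    unfolding diagonalizable_def empty_component_def by blast
  then show ?R
  proof cases
    case 1
    then show ?thesis by (intro exI[of _ "[]"]) simp
  next
    case 2
    then obtain ls where "distinct ls" "set ls = l_edges S" and
      P: "P = {(ls ! i, {v \<in> retained S. v \<in> ls ! i \<and> (\<forall>j<i. v \<notin> ls ! j)}) | i. i < length ls}"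
      unfolding s_partition_def by (elim exE conjE)
    moreover have "\<forall>i<length ls. d + 1 \<le> card {v \<in> retained S. v \<in> ls ! i \<and> (\<forall>j<i. v \<notin> ls ! j)}"
      using 2(2) unfolding P by auto
    ultimately show ?thesis by (intro exI[of _ ls] conjI)
  qed
next
  assume ?R
  then obtain ls where ls: "distinct ls" "set ls = l_edges S"
      "\<forall>i<length ls. d + 1 \<le> card {v \<in> retained S. v \<in> ls ! i \<and> (\<forall>j<i. v \<notin> ls ! j)}"
    by (elim exE conjE)
  let ?P = "{(ls ! i, {v \<in> retained S. v \<in> ls ! i \<and> (\<forall>j<i. v \<notin> ls ! j)}) | i. i < length ls}"
  have "s_partition S ?P"
    unfolding s_partition_def using ls(1,2) by (intro exI[of _ ls] conjI refl)
  moreover have "\<forall>(l, V)\<in>?P. d + 1 \<le> card V" using ls(3) by auto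
  ultimately show "diagonalizable d S"
    unfolding diagonalizable_def by (intro disjI2 exI[of _ ?P] conjI)
qed

text \<open>
  For the direct implication, the member of the given set that comes last in the ordering
  keeps only vertices lying on no other member. For the converse, peel: the \<open>l\<close>-edge supplied
  by the hypothesis goes to the end of an ordering of the others.
\<close>
lemma diagonalizable_iff_peelable:
  assumes fin: "finite (l_edges S)" "finite (retained S)"
  shows "diagonalizable d S \<longleftrightarrow>
    (\<forall>A\<subseteq>l_edges S. A \<noteq> {} \<longrightarrow> (\<exists>l\<in>A. d + 1 \<le> card (private_vertices S A l)))"
proof (intro iffI allI impI)
  fix A
  assume "diagonalizable d S" and A: "A \<subseteq> l_edges S" "A \<noteq> {}"
  then obtain ls where ls: "set ls = l_edges S"
      "\<And>i. i < length ls \<Longrightarrow>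
        d + 1 \<le> card {v \<in> retained S. v \<in> ls ! i \<and> (\<forall>j<i. v \<notin> ls ! j)}"
    unfolding diagonalizable_iff_ordering by blast
  define I where "I = {i. i < length ls \<and> ls ! i \<in> A}"
  define m where "m = Max I"
  obtain l where "l \<in> A" "l \<in> set ls" using A ls(1) by blast
  then have I: "finite I" "I \<noteq> {}"
    unfolding I_def by (auto simp: in_set_conv_nth)
  then have "m \<in> I" unfolding m_def by (rule Max_in)
  then have m: "m < length ls" "ls ! m \<in> A" unfolding I_def by auto
  have earlier: "\<exists>j<m. l' = ls ! j" if l': "l' \<in> A - {ls ! m}" for l'
  proof -
    obtain j where j: "j < length ls" "ls ! j = l'"
      using l' A ls(1) by (metis DiffD1 in_set_conv_nth subsetD)
    then have "j \<in> I" using l' unfolding I_def by simp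
    then have "j \<le> m" using I unfolding m_def by simp
    moreover have "j \<noteq> m" using j l' by auto
    ultimately show ?thesis using j by (intro exI[of _ j]) simp
  qed
  have "{v \<in> retained S. v \<in> ls ! m \<and> (\<forall>j<m. v \<notin> ls ! j)}
      \<subseteq> private_vertices S A (ls ! m)"
    unfolding private_vertices_def using earlier by fastforce
  from order_trans[OF ls(2)[OF m(1)] card_mono[OF finite_private_vertices[OF fin(2)] this]]
  have "d + 1 \<le> card (private_vertices S A (ls ! m))" .
  with m(2) show "\<exists>l\<in>A. d + 1 \<le> card (private_vertices S A l)" by blast
next
  assume peel: "\<forall>A\<subseteq>l_edges S. A \<noteq> {} \<longrightarrow>
    (\<exists>l\<in>A. d + 1 \<le> card (private_vertices S A l))"
  have "finite B \<Longrightarrow> B \<subseteq> l_edges S \<Longrightarrow> \<exists>ls. distinct ls \<and> set ls = B \<and>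
      (\<forall>i<length ls. d + 1 \<le> card {v \<in> retained S. v \<in> ls ! i \<and> (\<forall>j<i. v \<notin> ls ! j)})" for B
  proof (induction rule: finite_remove_induct)
    case empty
    then show ?case by simp
  next
    case (remove B)
    have "\<exists>l\<in>B. d + 1 \<le> card (private_vertices S B l)"
      using peel remove.prems remove.hyps by simp
    then obtain l where l: "l \<in> B" "d + 1 \<le> card (private_vertices S B l)" by blast
    moreover have "B - {l} \<subseteq> l_edges S" using remove.prems by blast
    ultimately obtain ls where ls: "distinct ls" "set ls = B - {l}"
        "\<forall>i<length ls. d + 1 \<le> card {v \<in> retained S. v \<in> ls ! i \<and> (\<forall>j<i. v \<notin> ls ! j)}"
      using remove.IH[of l] by (elim meta_impE exE conjE)
    have "private_vertices S B l = {v \<in> retained S. v \<in> l \<and> (\<forall>j<length ls. v \<notin> ls ! j)}"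
      unfolding private_vertices_def ls(2)[symmetric] by (auto simp: all_set_conv_all_nth)
    then have "d + 1 \<le> card {v \<in> retained S. v \<in> (ls @ [l]) ! i \<and> (\<forall>j<i. v \<notin> (ls @ [l]) ! j)}"
      if "i < length (ls @ [l])" for i
      using that ls(3) l(2) by (cases "i = length ls") (simp_all add: nth_append cong: conj_cong)
    moreover have "distinct (ls @ [l])" "set (ls @ [l]) = B" using ls l(1) by auto
    ultimately show ?case by (intro exI[of _ "ls @ [l]"]) blast
  qed
  from this[OF fin(1)] show "diagonalizable d S"
    unfolding diagonalizable_iff_ordering by simp
qed

section \<open>The core and regular partitions\<close>

definition first_part :: "component \<Rightarrow> point set set \<Rightarrow> component" where
  "first_part T L = \<lparr>l_edges = L, retained = {v \<in> retained T. \<exists>l\<in>L. v \<in> l}\<rparr>"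

definition second_part :: "component \<Rightarrow> point set set \<Rightarrow> component" where
  "second_part T L = \<lparr>l_edges = l_edges T - L,
     retained = {v \<in> retained T. (\<exists>l\<in>l_edges T - L. v \<in> l) \<and> (\<forall>l\<in>L. v \<notin> l)}\<rparr>"

lemma bipartition_iff:
  "bipartition T T1 T2 \<longleftrightarrow> (\<exists>L\<subseteq>l_edges T. T1 = first_part T L \<and> T2 = second_part T L)"
proof
  assume "bipartition T T1 T2"
  then obtain L1 L2 where L: "L1 \<union> L2 = l_edges T" "L1 \<inter> L2 = {}"
    and T: "T1 = \<lparr>l_edges = L1, retained = {v \<in> retained T. \<exists>l\<in>L1. v \<in> l}\<rparr>"
      "T2 = \<lparr>l_edges = L2,
        retained = {v \<in> retained T. (\<exists>l\<in>L2. v \<in> l) \<and> (\<forall>l\<in>L1. v \<notin> l)}\<rparr>"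
    unfolding bipartition_def by (elim exE conjE)
  from L have "L1 \<subseteq> l_edges T" "L2 = l_edges T - L1" by auto
  with T show "\<exists>L\<subseteq>l_edges T. T1 = first_part T L \<and> T2 = second_part T L"
    unfolding first_part_def second_part_def by (intro exI[of _ L1]) simp
next
  assume "\<exists>L\<subseteq>l_edges T. T1 = first_part T L \<and> T2 = second_part T L"
  then obtain L where "L \<subseteq> l_edges T" "T1 = first_part T L" "T2 = second_part T L" by blast
  moreover from this have "L \<union> (l_edges T - L) = l_edges T" "L \<inter> (l_edges T - L) = {}" by auto
  ultimately show "bipartition T T1 T2"
    unfolding bipartition_def first_part_def second_part_def
    by (intro exI[of _ L] exI[of _ "l_edges T - L"] conjI)
qed

text \<open>
  Omitting the vertices on the first part amounts to counting its \<open>l\<close>-edges among the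
  competitors; private vertices of both parts can thus be computed in \<open>T\<close>.
\<close>
lemma private_vertices_second_part:
  assumes "A \<subseteq> l_edges T - L" "l \<in> A"
  shows "private_vertices (second_part T L) A l = private_vertices T (L \<union> A) l"
  using assms unfolding private_vertices_def second_part_def by auto

lemma private_vertices_first_part:
  "l \<in> L \<Longrightarrow> private_vertices (first_part T L) A l = private_vertices T A l"
  unfolding private_vertices_def first_part_def by auto

definition stuck :: "nat \<Rightarrow> component \<Rightarrow> point set set \<Rightarrow> bool" where
  "stuck d T A \<longleftrightarrow> A \<subseteq> l_edges T \<and> (\<forall>l\<in>A. card (private_vertices T A l) \<le> d)"

definition core :: "nat \<Rightarrow> component \<Rightarrow> point set set" where
  "core d T = \<Union>{A. stuck d T A}"

text \<open>Enlarging a stuck set can only take private vertices away from its members.\<close>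
lemma card_private_vertices_le_of_stuck:
  assumes "finite (retained T)" "stuck d T A" "l \<in> A" "A \<subseteq> B"
  shows "card (private_vertices T B l) \<le> d"
  using card_mono[OF finite_private_vertices private_vertices_antimono, of T A B l] assms
  unfolding stuck_def by fastforce

lemma stuck_core:
  assumes "finite (retained T)"
  shows "stuck d T (core d T)"
  unfolding stuck_def
proof (intro conjI ballI)
  show "core d T \<subseteq> l_edges T" unfolding core_def stuck_def by blast
next
  fix l
  assume "l \<in> core d T"
  then obtain A where "stuck d T A" "l \<in> A" "A \<subseteq> core d T" unfolding core_def by blast
  then show "card (private_vertices T (core d T) l) \<le> d"
    using card_private_vertices_le_of_stuck assms by blast
qed

context
  fixes T :: component
  assumes fin: "finite (l_edges T)" "finite (retained T)"
begin

lemma diagonalizable_second_part_iff: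
  "diagonalizable d (second_part T L) \<longleftrightarrow>
    (\<forall>A\<subseteq>l_edges T - L. A \<noteq> {} \<longrightarrow> (\<exists>l\<in>A. d + 1 \<le> card (private_vertices T (L \<union> A) l)))"
proof -
  have "finite (l_edges (second_part T L))" "finite (retained (second_part T L))"
    using fin by (simp_all add: second_part_def)
  moreover have "l_edges (second_part T L) = l_edges T - L" by (simp add: second_part_def)
  ultimately show ?thesis
    using private_vertices_second_part
    by (simp add: diagonalizable_iff_peelable cong: bex_cong)
qed

text \<open>
  Otherwise the \<open>l\<close>-edges of the core outside \<open>L\<close> would include one with at least \<open>d + 1\<close>
  vertices lying neither on \<open>L\<close> nor on the rest of the core; but no member of the core has that
  many vertices off the other members.
\<close>
lemma core_subset_if_diagonalizable_second_part:
  assumes "diagonalizable d (second_part T L)"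
  shows "core d T \<subseteq> L"
proof (rule ccontr)
  let ?A = "core d T - L"
  assume "\<not> core d T \<subseteq> L"
  moreover have "?A \<subseteq> l_edges T - L" using stuck_core[OF fin(2)] unfolding stuck_def by blast
  ultimately obtain l where "l \<in> ?A" "d + 1 \<le> card (private_vertices T (L \<union> ?A) l)"
    using assms unfolding diagonalizable_second_part_iff by blast
  moreover from this have "card (private_vertices T (L \<union> ?A) l) \<le> d"
    by (intro card_private_vertices_le_of_stuck[OF fin(2) stuck_core[OF fin(2), of d]]) auto
  ultimately show False by linarith
qed

text \<open>
  If \<open>A\<close> is a nonempty set disjoint from the core, then its union with the core is not stuck,
  by maximality. The member that can be peeled is not in the core, so it is in \<open>A\<close>.
\<close>
lemma diagonalizable_second_part_core: "diagonalizable d (second_part T (core d T))"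
  unfolding diagonalizable_second_part_iff
proof (intro allI impI)
  fix A
  let ?B = "core d T \<union> A"
  assume A: "A \<subseteq> l_edges T - core d T" "A \<noteq> {}"
  then have "\<not> stuck d T ?B" unfolding core_def by blast
  moreover have "?B \<subseteq> l_edges T"
    using A stuck_core[OF fin(2), of d] unfolding stuck_def by blast
  ultimately obtain l where l: "l \<in> ?B" "d < card (private_vertices T ?B l)"
    unfolding stuck_def by (auto simp: not_le)
  moreover have "l \<notin> core d T"
    using l(2) card_private_vertices_le_of_stuck[OF fin(2) stuck_core[OF fin(2)], of l d ?B]
    by auto
  ultimately show "\<exists>l\<in>A. d + 1 \<le> card (private_vertices T ?B l)"
    by (intro bexI[of _ l]) auto
qed

lemma non_diagonalizable_first_part_core: "non_diagonalizable d (first_part T (core d T))"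
proof (cases "core d T = {}")
  case True
  then show ?thesis by (simp add: non_diagonalizable_def empty_component_def first_part_def)
next
  case False
  have core: "core d T \<subseteq> l_edges T" "\<forall>l\<in>core d T. card (private_vertices T (core d T) l) \<le> d"
    using stuck_core[OF fin(2), of d] unfolding stuck_def by auto
  have "finite (l_edges (first_part T (core d T)))" "finite (retained (first_part T (core d T)))"
    using fin core(1) finite_subset by (auto simp: first_part_def)
  moreover have "l_edges (first_part T (core d T)) = core d T" by (simp add: first_part_def)
  moreover have "\<forall>l\<in>core d T. card (private_vertices (first_part T (core d T)) (core d T) l) \<le> d"
    using core(2) by (simp add: private_vertices_first_part)
  ultimately have "\<not> diagonalizable d (first_part T (core d T))"
    using False by (auto simp: diagonalizable_iff_peelable intro!: exI[of _ "core d T"])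
  then show ?thesis by (simp add: non_diagonalizable_def)
qed

lemma regular_partition_core:
  "regular_partition d T (first_part T (core d T)) (second_part T (core d T))"
proof -
  have "core d T \<subseteq> l_edges T" using stuck_core[OF fin(2)] unfolding stuck_def by simp
  then have "bipartition T (first_part T (core d T)) (second_part T (core d T))"
    unfolding bipartition_iff by (intro exI[of _ "core d T"] conjI refl)
  then show ?thesis
    by (simp add: regular_partition_def non_diagonalizable_first_part_core
        diagonalizable_second_part_core)
qed

text \<open>
  The first part of every regular partition contains the core. Since a bipartition is
  determined by the \<open>l\<close>-edges of its first part, no other regular partition lies below the one
  given by the core, while that one lies below, and so rules out, every other candidate.
\<close>
theorem complete_partition_iff_core:
  "complete_partition d T T1 T2 \<longleftrightarrow>
     T1 = first_part T (core d T) \<and> T2 = second_part T (core d T)"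
proof -
  have regularD: "\<exists>L. core d T \<subseteq> L \<and> U1 = first_part T L \<and> U2 = second_part T L"
    if "regular_partition d T U1 U2" for U1 U2
  proof -
    from that obtain L where L: "U1 = first_part T L" "U2 = second_part T L"
        "diagonalizable d U2"
      unfolding regular_partition_def bipartition_iff by (elim exE conjE)
    then have "core d T \<subseteq> L" using core_subset_if_diagonalizable_second_part by simp
    with L(1,2) show ?thesis by (intro exI[of _ L] conjI)
  qed
  show ?thesis
  proof
    assume c: "complete_partition d T T1 T2"
    then have "regular_partition d T T1 T2" by (simp add: complete_partition_def)
    then obtain L where L: "core d T \<subseteq> L" "T1 = first_part T L" "T2 = second_part T L"
      using regularD by blast
    from L(1,2) have "component_le (first_part T (core d T)) T1"
      unfolding component_le_def first_part_def by auto
    with c regular_partition_core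
    have "(first_part T (core d T), second_part T (core d T)) = (T1, T2)"
      unfolding complete_partition_def by blast
    then show "T1 = first_part T (core d T) \<and> T2 = second_part T (core d T)" by simp
  next
    assume eq: "T1 = first_part T (core d T) \<and> T2 = second_part T (core d T)"
    have "(U1, U2) = (T1, T2)"
      if U: "regular_partition d T U1 U2" and le: "component_le U1 T1" for U1 U2
    proof -
      obtain L where L: "core d T \<subseteq> L" "U1 = first_part T L" "U2 = second_part T L"
        using regularD[OF U] by blast
      then have "L \<subseteq> core d T"
        using le eq by (simp add: component_le_def first_part_def)
      with L eq show ?thesis by auto
    qed
    moreover have "regular_partition d T T1 T2" using eq regular_partition_core by simp
    ultimately show "complete_partition d T T1 T2" unfolding complete_partition_def by blast
  qed
qed

end

section \<open>Meshes\<close>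

lemma finite_l_edges_T_component:
  assumes "is_tmesh M"
  shows "finite (l_edges (T_component M))"
proof -
  have "T_l_edges M \<subseteq> Union ` Pow (edges M)"
  proof
    fix l
    assume "l \<in> T_l_edges M"
    then have "mesh_segment M l" by (simp add: T_l_edges_def interior_l_edge_def l_edge_def)
    then obtain E where "E \<subseteq> edges M" "l = \<Union>E" unfolding mesh_segment_def by (elim exE conjE)
    then show "l \<in> Union ` Pow (edges M)" by simp
  qed
  moreover have "finite (edges M)" using assms unfolding is_tmesh_def by (elim conjE)
  ultimately have "finite (T_l_edges M)" by (meson finite_Pow_iff finite_imageI finite_subset)
  then show ?thesis by (simp add: T_component_def)
qed

lemma finite_retained_T_component:
  assumes "is_tmesh M"
  shows "finite (retained (T_component M))"
proof -
  have M: "finite (edges M)" "vertices M = (\<Union>l\<in>edges M. endpoints l)"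
    using assms unfolding is_tmesh_def by simp_all
  have hv: "\<forall>l\<in>edges M. horizontal l \<or> vertical l"
    using assms unfolding is_tmesh_def by (elim conjE)
  have "finite (endpoints l)" if "l \<in> edges M" for l
    using bspec[OF hv that] unfolding horizontal_def vertical_def
    by (auto simp: endpoints_closed_segment)
  with M have "finite (vertices M)" by simp
  then show ?thesis by (simp add: T_component_def)
qed

theorem theorem4p1:
  fixes d :: nat and M :: tmesh
  assumes "1 \<le> d"
    and "is_tmesh M"
    and "component_connected (T_component M)"
    and "\<forall>l\<in>T_l_edges M. \<not> vanishable d M l"
  shows "\<exists>!P. case P of (T_CNDC, T_D) \<Rightarrow> complete_partition d (T_component M) T_CNDC T_D"
proof -
  let ?T = "T_component M"
  have iff: "complete_partition d ?T T1 T2 \<longleftrightarrow>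
      T1 = first_part ?T (core d ?T) \<and> T2 = second_part ?T (core d ?T)" for T1 T2
    by (rule complete_partition_iff_core[OF finite_l_edges_T_component[OF assms(2)]
          finite_retained_T_component[OF assms(2)]])
  show ?thesis unfolding iff by auto
qed

end
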